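(* Let $d=1$. Let $\{Z_n\}_{n\ge0}$ be a branching random walk on $\mathbb{R}$ started from a single particle at the origin, with offspring law $\{p_k\}_{k\ge0}$ satisfying $\sum_kkp_k=1$ and $p_1<1$, and real step size $X$ with $\mathbb{E}[X]=0$ and $\mathrm{Var}(X)>0$. Let $\sigma^2:=\sum_kk^2p_k-1$, $\eta^2:=\mathbb{E}[X^2]$, and let $M:=\max_{n\ge0}\max_{u\in Z_n}S_u$ be the maximal displacement. Assume $\sigma^2<\infty$, $\eta^2<\infty$ and $\mathbb{E}[(X^+)^4]<\infty$. Then $$\lim_{x\to+\infty}x^2\,\mathbb{P}_{\delta_0}(M\ge x)=\frac{6\eta^2}{\sigma^2}.$$
   Context: Branching random walk: generation $0$ is one particle at $0$ (law $\mathbb{P}_{\delta_0}$). At each step, every particle alive independently produces a random number of children with law $\{p_k\}$ (and is replaced by them), and each child jumps from its parent's position by an independent copy of $X$; branching and displacements are independent. $S_u$ is the position of particle $u$, and $u\in Z_n$ means that $u$ is a particle of generation $n$ (the maximum over an empty generation is ignored). $X^+=\max\{X,0\}$. *)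

theory Defs
  imports "HOL-Probability.Probability"
begin

text \<open>Particles carry Ulam--Harris labels: the root is \<open>[]\<close> and the \<open>i\<close>-th child of \<open>u\<close>
  (counting from \<open>0\<close>) is \<open>u @ [i]\<close>. The variable \<open>N u\<close> is the number of children of \<open>u\<close>, and
  for \<open>v \<noteq> []\<close> the variable \<open>X v\<close> is the jump of \<open>v\<close> from the position of its parent; \<open>X []\<close> is
  never used. Both families are defined for all labels, alive or not.\<close>

locale branching_random_walk = prob_space P
  for P :: "'a measure"
    and p :: "nat pmf"
    and \<mu> :: "real measure"
    and N :: "nat list \<Rightarrow> 'a \<Rightarrow> nat"
    and X :: "nat list \<Rightarrow> 'a \<Rightarrow> real" +
  assumes offspring_measurable: "\<And>u. N u \<in> measurable P (count_space UNIV)"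
    and offspring_law: "\<And>u. distr P (count_space UNIV) (N u) = measure_pmf p"
    and step_measurable: "\<And>v. v \<noteq> [] \<Longrightarrow> X v \<in> borel_measurable P"
    and step_law: "\<And>v. v \<noteq> [] \<Longrightarrow> distr P borel (X v) = \<mu>"
    \<comment> \<open>joint independence of all offspring numbers and all jumps; the offspring numbers are
      regarded as reals so that the family has a single value type\<close>
    and independence: "indep_vars (\<lambda>_. borel)
      (\<lambda>s. case s of Inl u \<Rightarrow> (\<lambda>\<omega>. real (N u \<omega>)) | Inr v \<Rightarrow> X v) (UNIV <+> - {[]})"

primrec generation :: "(nat list \<Rightarrow> 'a \<Rightarrow> nat) \<Rightarrow> nat \<Rightarrow> 'a \<Rightarrow> nat list set" where
  "generation N 0 \<omega> = {[]}"
| "generation N (Suc n) \<omega> = {u @ [i] | u i. u \<in> generation N n \<omega> \<and> i < N u \<omega>}"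

definition position :: "(nat list \<Rightarrow> 'a \<Rightarrow> real) \<Rightarrow> nat list \<Rightarrow> 'a \<Rightarrow> real" where
  "position X u \<omega> = (\<Sum>k = 1..length u. X (take k u) \<omega>)"

text \<open>The maximum is rendered as a supremum in the extended reals, so that it is defined for every
  outcome. An empty generation contributes \<open>- \<infinity>\<close> and is thus ignored. In the critical case with
  \<open>p\<^sub>1 < 1\<close> almost surely only finitely many particles are ever born, and the supremum is then a
  maximum.\<close>

definition maximal_displacement ::
    "(nat list \<Rightarrow> 'a \<Rightarrow> nat) \<Rightarrow> (nat list \<Rightarrow> 'a \<Rightarrow> real) \<Rightarrow> 'a \<Rightarrow> ereal" where
  "maximal_displacement N X \<omega> = (SUP n. SUP u \<in> generation N n \<omega>. ereal (position X u \<omega>))"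

end

theory Submission
  imports Defs "HOL-Real_Asymp.Real_Asymp"
begin

text \<open>Let \<open>w x\<close> be the probability that some particle exceeds \<open>x\<close> and \<open>h v = 1 - f (1 - v)\<close> with
  the offspring generating function \<open>f\<close>. Decomposition at the root gives \<open>w x = h (E (w (x - X)))\<close> for
  \<open>x \<ge> 0\<close> and \<open>w x = 1\<close> for \<open>x < 0\<close>. Since \<open>h\<close> is increasing and concave with \<open>h v < v\<close> for \<open>v > 0\<close>,
  sub- and supersolutions of this equation can be compared, and \<open>w\<close> tends to \<open>0\<close>.

  For the truncated inverse square \<open>g z = min 1 (A / z\<^sup>2)\<close> a second order expansion yields
  \<open>z\<^sup>4 (h (E (g (z - X))) - g z) \<longlonglongrightarrow> A (3 \<eta>\<^sup>2 - A \<sigma>\<^sup>2 / 2)\<close>; the fourth moment of \<open>X\<^sup>+\<close> controls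
  the jumps into the region where \<open>g\<close> is truncated. Hence \<open>g\<close> is a supersolution far out if
  \<open>A > 6 \<eta>\<^sup>2 / \<sigma>\<^sup>2\<close> and a subsolution if \<open>A < 6 \<eta>\<^sup>2 / \<sigma>\<^sup>2\<close>, and suitable translates of it squeeze \<open>w\<close>.\<close>

section \<open>The offspring law\<close>

text \<open>The probability that some child succeeds, when the children succeed independently with
  probability \<open>v\<close> each; this is \<open>1 - f (1 - v)\<close> for the offspring generating function \<open>f\<close>.\<close>

definition hit_prob :: "nat pmf \<Rightarrow> real \<Rightarrow> real" where
  "hit_prob p v = measure_pmf.expectation p (\<lambda>k. 1 - (1 - v) ^ k)"

section \<open>Elementary estimates for \<open>(1 - v) ^ k\<close>\<close>

lemma one_minus_power_le_mult:
  fixes v :: real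
  assumes "0 \<le> v" "v \<le> 1"
  shows "1 - (1 - v) ^ k \<le> real k * v"
  using Bernoulli_inequality[of "- v" k] assms by simp

text \<open>Passing from \<open>k\<close> to \<open>Suc k\<close> adds
  \<open>v * (1 - (1 - v) ^ k)\<close>, which lies between 0 and \<open>real k * v\<^sup>2\<close>.
  The crude factor \<open>(real k)\<^sup>2\<close> is good enough as a majorant under a finite
  second moment.\<close>

lemma power_remainder_bounds:
  fixes v :: real
  assumes "0 \<le> v" "v \<le> 1"
  shows "0 \<le> (1 - v) ^ k - 1 + real k * v" "(1 - v) ^ k - 1 + real k * v \<le> (real k)\<^sup>2 * v\<^sup>2"
proof -
  show "0 \<le> (1 - v) ^ k - 1 + real k * v"
    using one_minus_power_le_mult[OF assms, of k] by simp
  show "(1 - v) ^ k - 1 + real k * v \<le> (real k)\<^sup>2 * v\<^sup>2"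
  proof (induction k)
    case (Suc k)
    have "(1 - v) ^ Suc k - 1 + real (Suc k) * v
        = ((1 - v) ^ k - 1 + real k * v) + v * (1 - (1 - v) ^ k)"
      by (simp add: algebra_simps)
    also have "\<dots> \<le> (real k)\<^sup>2 * v\<^sup>2 + v * (real k * v)"
      using Suc one_minus_power_le_mult[OF assms, of k] assms by (intro add_mono mult_left_mono) auto
    also have "\<dots> \<le> (real (Suc k))\<^sup>2 * v\<^sup>2"
      using assms by (simp add: power2_eq_square algebra_simps)
    finally show ?case .
  qed simp
qed

text \<open>The increments are nonnegative and \<open>k = 2\<close> already gives
  \<open>v\<^sup>2\<close>. This strictness is what rules out nonzero solutions of
  \<open>v \<le> hit_prob p v\<close>.\<close>

lemma power_remainder_pos:
  fixes v :: real
  assumes "0 < v" "v \<le> 1" "2 \<le> k"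
  shows "0 < (1 - v) ^ k - 1 + real k * v"
  using assms(3)
proof (induction k rule: dec_induct)
  case base
  show ?case using assms by (simp add: power2_eq_square algebra_simps)
next
  case (step k)
  have "v * (1 - v) ^ k \<le> v * 1"
    using assms by (intro mult_left_mono power_le_one) auto
  then show ?case using step by (simp add: algebra_simps)
qed

text \<open>The limit is the binomial coefficient \<open>k choose 2\<close>, reached by induction:
  each step adds the first-order quotient, whose limit \<open>k\<close> is
  \<open>lin\<close>.\<close>

lemma tendsto_power_remainder:
  assumes "(v \<longlongrightarrow> 0) F" "\<forall>\<^sub>F z in F. v z > (0::real)"
  shows "((\<lambda>z. ((1 - v z) ^ k - 1 + real k * v z) / (v z)\<^sup>2) \<longlongrightarrow> real k * (real k - 1) / 2) F"
proof -
  have lin: "((\<lambda>z. (1 - (1 - v z) ^ k) / v z) \<longlongrightarrow> real k) F" for k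
  proof (induction k)
    case (Suc k)
    have "((\<lambda>z. (1 - (1 - v z) ^ k) / v z * (1 - v z) + 1) \<longlongrightarrow> real k * (1 - 0) + 1) F"
      by (intro tendsto_intros Suc assms)
    moreover have "\<forall>\<^sub>F z in F. (1 - (1 - v z) ^ k) / v z * (1 - v z) + 1 = (1 - (1 - v z) ^ Suc k) / v z"
      using assms(2) by eventually_elim (simp add: field_simps)
    ultimately show ?case
      by (subst (asm) tendsto_cong) (auto simp: add.commute)
  qed simp
  show ?thesis
  proof (induction k)
    case (Suc k)
    have "((\<lambda>z. ((1 - v z) ^ k - 1 + real k * v z) / (v z)\<^sup>2 + (1 - (1 - v z) ^ k) / v z)
        \<longlongrightarrow> real k * (real k - 1) / 2 + real k) F"
      by (intro tendsto_intros Suc lin)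
    moreover have "\<forall>\<^sub>F z in F. ((1 - v z) ^ k - 1 + real k * v z) / (v z)\<^sup>2 + (1 - (1 - v z) ^ k) / v z
       = ((1 - v z) ^ Suc k - 1 + real (Suc k) * v z) / (v z)\<^sup>2"
      using assms(2) by eventually_elim (simp add: field_simps power2_eq_square)
    ultimately show ?case
      by (subst (asm) tendsto_cong) (auto simp: field_simps)
  qed simp
qed

text \<open>On the unit interval \<open>1 - (1 - v) ^ k\<close> is concave in \<open>v\<close>, so
  its increment over an interval of given length is largest when the interval starts at 0.\<close>

lemma power_diff_le_one_minus_power:
  fixes a b :: real
  assumes "0 \<le> b" "b \<le> a" "a \<le> 1"
  shows "(1 - b) ^ k - (1 - a) ^ k \<le> 1 - (1 - (a - b)) ^ k"
proof (induction k)
  case (Suc k)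
  have "(1 - b) ^ Suc k - (1 - a) ^ Suc k
      = (1 - b) * ((1 - b) ^ k - (1 - a) ^ k) + (a - b) * (1 - a) ^ k"
    by (simp add: algebra_simps)
  also have "\<dots> \<le> 1 * ((1 - b) ^ k - (1 - a) ^ k) + (a - b) * (1 - (a - b)) ^ k"
    using assms by (intro add_mono mult_mono mult_right_mono power_mono diff_ge_0_iff_ge[THEN iffD2]) auto
  also have "\<dots> \<le> 1 - (1 - (a - b)) ^ k + (a - b) * (1 - (a - b)) ^ k"
    using Suc by simp
  also have "\<dots> = 1 - (1 - (a - b)) ^ Suc k" by (simp add: algebra_simps)
  finally show ?case .
qed simp

section \<open>Monotonicity and increments of \<open>hit_prob\<close>\<close>

lemma integrable_hit_prob:
  assumes "0 \<le> v" "v \<le> 1"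
  shows "integrable (measure_pmf p) (\<lambda>k. 1 - (1 - v :: real) ^ k)"
  using assms
  by (intro measure_pmf.integrable_const_bound[where B=1]) (auto simp: power_le_one)

lemma hit_prob_0 [simp]: "hit_prob p 0 = 0"
  by (simp add: hit_prob_def)

lemma hit_prob_mono:
  assumes "0 \<le> a" "a \<le> b" "b \<le> 1"
  shows "hit_prob p a \<le> hit_prob p b"
  unfolding hit_prob_def using assms
  by (intro integral_mono integrable_hit_prob) (auto intro!: power_mono)

lemma hit_prob_nonneg:
  assumes "0 \<le> a" "a \<le> 1"
  shows "0 \<le> hit_prob p a"
  using hit_prob_mono[of 0 a p] assms by simp

lemma hit_prob_diff_le:
  assumes "0 \<le> b" "b \<le> a" "a \<le> 1"
  shows "hit_prob p a - hit_prob p b \<le> hit_prob p (a - b)"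
proof -
  have "hit_prob p a - hit_prob p b
      = measure_pmf.expectation p (\<lambda>k. (1 - (1 - a) ^ k) - (1 - (1 - b) ^ k))"
    unfolding hit_prob_def using assms
    by (intro Bochner_Integration.integral_diff[symmetric] integrable_hit_prob) auto
  also have "\<dots> \<le> hit_prob p (a - b)"
    unfolding hit_prob_def using assms power_diff_le_one_minus_power[OF assms]
    by (intro integral_mono integrable_hit_prob Bochner_Integration.integrable_diff) (auto simp: algebra_simps)
  finally show ?thesis .
qed

section \<open>Moments of the critical offspring law\<close>

lemma has_bochner_integral_pmf_nat:
  fixes f :: "nat \<Rightarrow> real" and q :: "nat pmf"
  assumes "(\<lambda>k. f k * pmf q k) sums s" "\<And>k. 0 \<le> f k"
  shows "has_bochner_integral (measure_pmf q) f s"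
proof -
  have "integrable (count_space UNIV) (\<lambda>k. f k * pmf q k)"
    using assms by (auto simp: integrable_count_space_nat_iff sums_iff)
  then have "has_bochner_integral (count_space UNIV) (\<lambda>k. pmf q k *\<^sub>R f k) s"
    using assms by (auto simp: has_bochner_integral_iff integral_count_space_nat sums_iff mult.commute)
  then show ?thesis
    unfolding measure_pmf_eq_density
    by (intro has_bochner_integral_density) (auto simp: )
qed

text \<open>Since the mean is 1, the second moment \<open>\<sigma>2 + 1\<close> makes
  \<open>\<sigma>2\<close> the variance.\<close>

locale critical_offspring =
  fixes p :: "nat pmf" and \<sigma>2 :: real
  assumes mean_sums: "(\<lambda>k. real k * pmf p k) sums 1"
    and nontrivial: "pmf p 1 < 1"
    and second_moment_sums: "(\<lambda>k. (real k)\<^sup>2 * pmf p k) sums (\<sigma>2 + 1)"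
begin

lemma mean: "has_bochner_integral (measure_pmf p) real 1"
  using has_bochner_integral_pmf_nat[OF mean_sums] by simp

lemma second_moment: "has_bochner_integral (measure_pmf p) (\<lambda>k. (real k)\<^sup>2) (\<sigma>2 + 1)"
  using has_bochner_integral_pmf_nat[OF second_moment_sums] by simp

text \<open>A law carried by 0 and 1 with mean 1 has all its mass at 1, contrary to
  \<open>nontrivial\<close>.\<close>

lemma ex_two_children: "\<exists>k\<ge>2. k \<in> set_pmf p"
proof (rule ccontr)
  assume "\<not> ?thesis"
  then have "set_pmf p \<subseteq> {0, 1}" by (metis One_nat_def insertCI less_2_cases not_less subsetI)
  then have "real k * pmf p k = 0" if "k \<notin> {1}" for k
    using that by (cases "k = 0") (auto simp: set_pmf_iff)
  then have "(\<lambda>k. real k * pmf p k) sums (\<Sum>k\<in>{1}. real k * pmf p k)"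
    by (intro sums_finite) auto
  then have "pmf p 1 = 1" using sums_unique2[OF mean_sums] by fastforce
  then show False using nontrivial by simp
qed

lemma integrable_power_remainder:
  assumes "0 \<le> v" "v \<le> 1"
  shows "integrable (measure_pmf p) (\<lambda>k. (1 - v) ^ k - 1 + real k * v)"
  by (rule Bochner_Integration.integrable_bound[of _ "\<lambda>k. (real k)\<^sup>2 * v\<^sup>2"])
    (use second_moment power_remainder_bounds[OF assms] in \<open>auto simp: has_bochner_integral_iff intro!: AE_I2\<close>)

lemma diff_hit_prob:
  assumes "0 \<le> v" "v \<le> 1"
  shows "v - hit_prob p v = measure_pmf.expectation p (\<lambda>k. (1 - v) ^ k - 1 + real k * v)"
proof -
  have "measure_pmf.expectation p (\<lambda>k. real k * v - (1 - (1 - v) ^ k)) = v - hit_prob p v"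
    unfolding hit_prob_def using mean integrable_hit_prob[OF assms]
    by (subst Bochner_Integration.integral_diff) (auto simp: has_bochner_integral_iff)
  then show ?thesis by (simp add: algebra_simps)
qed

text \<open>By \<open>diff_hit_prob\<close> the gap is the mean of a nonnegative remainder that is
  strictly positive at some \<open>k \<ge> 2\<close> in the support.\<close>

lemma hit_prob_less:
  assumes "0 < v" "v \<le> 1"
  shows "hit_prob p v < v"
proof -
  obtain k where k: "2 \<le> k" "k \<in> set_pmf p" using ex_two_children by blast
  let ?r = "\<lambda>k. (1 - v) ^ k - 1 + real k * v"
  have "0 < measure_pmf.expectation p ?r"
  proof (rule ccontr)
    assume "\<not> ?thesis"
    moreover have nn: "0 \<le> ?r j" for j using power_remainder_bounds(1)[of v j] assms by simp
    ultimately have "measure_pmf.expectation p ?r = 0"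
      by (intro antisym Bochner_Integration.integral_nonneg) auto
    then have "AE j in measure_pmf p. ?r j = 0"
      using integrable_power_remainder[of v] assms nn by (subst (asm) integral_nonneg_eq_0_iff_AE) auto
    then have "?r k = 0" using k by (auto simp: AE_measure_pmf_iff)
    then show False using power_remainder_pos[OF assms k(1)] by simp
  qed
  then show ?thesis using diff_hit_prob[of v] assms by simp
qed

lemma hit_prob_le:
  assumes "0 \<le> v" "v \<le> 1"
  shows "hit_prob p v \<le> v"
  using hit_prob_less[of v] assms by (cases "v = 0") auto

text \<open>\<open>\<sigma>2\<close> is the mean of \<open>(real k - 1)\<^sup>2\<close>, which is
  positive at an atom \<open>k \<ge> 2\<close>.\<close>

lemma variance_pos: "0 < \<sigma>2"
proof -
  have i: "has_bochner_integral (measure_pmf p) (\<lambda>k. (real k)\<^sup>2 - 2 * real k + 1) (\<sigma>2 + 1 - 2 * 1 + 1)"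
    using has_bochner_integral_add[OF has_bochner_integral_diff[OF second_moment
          has_bochner_integral_mult_right[OF mean, of 2]], of "\<lambda>_. 1" 1]
    by (simp add: has_bochner_integral_iff)
  have eq: "(\<lambda>k. (real k)\<^sup>2 - 2 * real k + 1) = (\<lambda>k. (real k - 1)\<^sup>2)"
    by (auto simp: power2_eq_square algebra_simps)
  have i: "integrable (measure_pmf p) (\<lambda>k. (real k - 1)\<^sup>2)"
      "measure_pmf.expectation p (\<lambda>k. (real k - 1)\<^sup>2) = \<sigma>2"
    using i unfolding eq by (auto simp: has_bochner_integral_iff)
  obtain k where k: "2 \<le> k" "k \<in> set_pmf p" using ex_two_children by blast
  show ?thesis
  proof (rule ccontr)
    assume "\<not> 0 < \<sigma>2"
    moreover have "0 \<le> \<sigma>2" using i(2) by (metis Bochner_Integration.integral_nonneg zero_le_power2)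
    ultimately have "AE k in measure_pmf p. (real k - 1)\<^sup>2 = 0"
      using i by (subst integral_nonneg_eq_0_iff_AE[symmetric]) auto
    then have "(real k - 1)\<^sup>2 = 0" using k by (simp add: AE_measure_pmf_iff)
    then show False using k by simp
  qed
qed

text \<open>Dominated convergence in \<open>diff_hit_prob\<close> with majorant
  \<open>(real k)\<^sup>2\<close>. The limit is half the mean of \<open>k * (k - 1)\<close>, and
  this factorial moment equals \<open>\<sigma>2\<close> because the mean of \<open>k\<close> is
  1.\<close>

lemma hit_prob_expansion:
  fixes v :: "real \<Rightarrow> real"
  assumes "(v \<longlongrightarrow> 0) at_top" "\<forall>\<^sub>F z in at_top. 0 < v z"
  shows "((\<lambda>z. (v z - hit_prob p (v z)) / (v z)\<^sup>2) \<longlongrightarrow> \<sigma>2 / 2) at_top"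
proof -
  have ev: "\<forall>\<^sub>F z in at_top. 0 < v z \<and> v z \<le> 1"
    using assms(2) order_tendstoD(2)[OF assms(1), of 1] by (auto elim: eventually_elim2)
  let ?r = "\<lambda>z k. ((1 - v z) ^ k - 1 + real k * v z) / (v z)\<^sup>2"
  have lim: "((\<lambda>z. measure_pmf.expectation p (?r z)) \<longlongrightarrow>
      measure_pmf.expectation p (\<lambda>k. real k * (real k - 1) / 2)) at_top"
  proof (rule integral_dominated_convergence_at_top[where w="\<lambda>k. (real k)\<^sup>2"])
    show "\<forall>\<^sub>F z in at_top. AE k in measure_pmf p. norm (?r z k) \<le> (real k)\<^sup>2"
      using ev
    proof eventually_elim
      case (elim z)
      then show ?case using power_remainder_bounds[of "v z"]
        by (intro AE_I2) (simp add: field_simps)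
    qed
    show "AE k in measure_pmf p. ((\<lambda>z. ?r z k) \<longlongrightarrow> real k * (real k - 1) / 2) at_top"
      by (intro AE_I2 tendsto_power_remainder assms)
  qed (use second_moment in \<open>auto simp: has_bochner_integral_iff\<close>)
  have limit_eq: "measure_pmf.expectation p (\<lambda>k. real k * (real k - 1) / 2) = \<sigma>2 / 2"
  proof -
    have "measure_pmf.expectation p (\<lambda>k. (real k)\<^sup>2 - real k) = \<sigma>2"
      using mean second_moment by (subst Bochner_Integration.integral_diff) (auto simp: has_bochner_integral_iff)
    then show ?thesis by (simp add: algebra_simps power2_eq_square)
  qed
  have "\<forall>\<^sub>F z in at_top. measure_pmf.expectation p (?r z) = (v z - hit_prob p (v z)) / (v z)\<^sup>2"
    using ev by eventually_elim (simp add: diff_hit_prob)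
  from Lim_transform_eventually[OF lim this] show ?thesis unfolding limit_eq .
qed

end

section \<open>Comparison principle and barriers\<close>

context critical_offspring
begin

text \<open>If \<open>D\<close> is the supremum of \<open>(u - \<psi>)\<^sup>+\<close>, then concavity in the form \<open>hit_prob_diff_le\<close> gives
  \<open>D \<le> hit_prob p D\<close>, which forces \<open>D = 0\<close>. No control of \<open>u\<close> or \<open>\<psi>\<close> at infinity is needed.\<close>

lemma hit_prob_comparison:
  fixes u \<psi> :: "real \<Rightarrow> real"
  assumes \<mu>: "prob_space \<mu>" "sets \<mu> = sets borel"
    and u: "u \<in> borel_measurable borel" "\<And>x. 0 \<le> u x" "\<And>x. u x \<le> 1"
    and \<psi>: "\<psi> \<in> borel_measurable borel" "\<And>x. 0 \<le> \<psi> x" "\<And>x. \<psi> x \<le> 1"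
    and sub: "\<And>x. x \<in> S \<Longrightarrow> u x \<le> hit_prob p (\<integral>y. u (x - y) \<partial>\<mu>)"
    and super: "\<And>x. x \<in> S \<Longrightarrow> hit_prob p (\<integral>y. \<psi> (x - y) \<partial>\<mu>) \<le> \<psi> x"
    and boundary: "\<And>x. x \<notin> S \<Longrightarrow> u x \<le> \<psi> x"
  shows "u x \<le> \<psi> x"
proof -
  interpret \<mu>: prob_space \<mu> by fact
  have [measurable_cong]: "sets \<mu> = sets borel" by fact
  note [measurable] = u(1) \<psi>(1)
  have int_u: "integrable \<mu> (\<lambda>y. u (x - y))" for x
    by (rule \<mu>.integrable_const_bound[where B=1]) (use u in auto)
  have int_\<psi>: "integrable \<mu> (\<lambda>y. \<psi> (x - y))" for x
    by (rule \<mu>.integrable_const_bound[where B=1]) (use \<psi> in auto)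
  define D where "D = (SUP x. max 0 (u x - \<psi> x))"
  have bdd: "bdd_above (range (\<lambda>x. max 0 (u x - \<psi> x)))"
    by (rule bdd_aboveI[of _ 1]) (use u(3) \<psi>(2) in \<open>force simp: max_def diff_le_eq add_increasing2\<close>)
  have le_D: "max 0 (u x - \<psi> x) \<le> D" for x
    unfolding D_def by (rule cSUP_upper[OF _ bdd]) simp
  have D: "0 \<le> D" "D \<le> 1"
  proof -
    show "0 \<le> D" using le_D[of 0] by simp
    show "D \<le> 1" unfolding D_def
      by (rule cSUP_least) (use u(3) \<psi>(2) in \<open>force simp: max_def diff_le_eq add_increasing2\<close>)+
  qed
  have "max 0 (u x - \<psi> x) \<le> hit_prob p D" for x
  proof (cases "x \<in> S")
    case True
    define a b where "a = (\<integral>y. u (x - y) \<partial>\<mu>)" and "b = (\<integral>y. \<psi> (x - y) \<partial>\<mu>)"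
    have a: "0 \<le> a" "a \<le> 1"
      unfolding a_def using u by (auto intro!: \<mu>.integral_le_const int_u Bochner_Integration.integral_nonneg)
    have b: "0 \<le> b" "b \<le> 1"
      unfolding b_def using \<psi> by (auto intro!: \<mu>.integral_le_const int_\<psi> Bochner_Integration.integral_nonneg)
    have "a - b = (\<integral>y. u (x - y) - \<psi> (x - y) \<partial>\<mu>)"
      unfolding a_def b_def by (simp add: int_u int_\<psi>)
    also have "\<dots> \<le> D"
      using le_D by (intro \<mu>.integral_le_const Bochner_Integration.integrable_diff int_u int_\<psi> AE_I2)
        (metis max.bounded_iff)
    finally have ab: "a - b \<le> D" .
    have "hit_prob p a - hit_prob p b \<le> hit_prob p D"
    proof (cases "b \<le> a")
      case True
      then have "hit_prob p a - hit_prob p b \<le> hit_prob p (a - b)"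
        using a b by (intro hit_prob_diff_le) auto
      also have "\<dots> \<le> hit_prob p D"
        using True ab D by (intro hit_prob_mono) auto
      finally show ?thesis .
    next
      case False
      then have "hit_prob p a \<le> hit_prob p b" using a b by (intro hit_prob_mono) auto
      then show ?thesis using hit_prob_nonneg[OF D, of p] by simp
    qed
    then show ?thesis
      using sub[OF True] super[OF True] hit_prob_nonneg[OF D, of p] unfolding a_def b_def by simp
  next
    case False
    then show ?thesis using boundary[OF False] hit_prob_nonneg[OF D, of p] by simp
  qed
  then have "D \<le> hit_prob p D" unfolding D_def by (intro cSUP_least) auto
  then have "D = 0" using hit_prob_less[of D] D by (cases "D = 0") auto
  then show ?thesis using le_D[of x] by simp
qed

end

lemma borel_measurable_antimono:
  fixes f :: "real \<Rightarrow> real"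
  assumes "antimono f"
  shows "f \<in> borel_measurable borel"
proof -
  have "mono (\<lambda>x. - f x)" using assms by (simp add: monotone_def)
  then have "(\<lambda>x. - f x) \<in> borel_measurable borel" by (rule borel_measurable_mono)
  then show ?thesis by simp
qed

text \<open>The mean-field equation \<open>\<eta>\<^sup>2 / 2 \<cdot> w'' = \<sigma>\<^sup>2 / 2 \<cdot> w\<^sup>2\<close> has the solution \<open>A / z\<^sup>2\<close> with
  \<open>A = 6 \<eta>\<^sup>2 / \<sigma>\<^sup>2\<close>. Truncation at \<open>1\<close> makes it a candidate bound on the whole line.\<close>

definition barrier :: "real \<Rightarrow> real \<Rightarrow> real" where
  "barrier A z = (if z \<le> 0 then 1 else min 1 (A / z\<^sup>2))"

section \<open>Taylor remainder of the barrier\<close>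

lemma barrier_measurable [measurable]: "barrier A \<in> borel_measurable borel"
  unfolding barrier_def by measurable

lemma barrier_bounds:
  assumes "0 \<le> A"
  shows "0 \<le> barrier A z" "barrier A z \<le> 1"
  using assms by (auto simp: barrier_def)

lemma barrier_eq:
  assumes "0 < z" "A \<le> z\<^sup>2"
  shows "barrier A z = A / z\<^sup>2"
  using assms by (auto simp: barrier_def min_def field_simps)

text \<open>Exact remainder after the linear Taylor term of \<open>A / (z - y)\<^sup>2\<close> in
  \<open>y\<close>; for fixed \<open>y\<close> the last factor tends to 3.\<close>

lemma inverse_square_remainder:
  fixes z y :: real
  assumes "0 < z" "y < z"
  shows "z ^ 4 * (A / (z - y)\<^sup>2 - A / z\<^sup>2 - 2 * A * y / z ^ 3)
    = A * y\<^sup>2 * (z * (3 * z - 2 * y) / (z - y)\<^sup>2)"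
proof -
  have "z \<noteq> 0" "z - y \<noteq> 0" using assms by auto
  then show ?thesis
    by (simp add: divide_simps) algebra
qed

text \<open>A majorant uniform in \<open>z\<close>, found in three regimes. For
  \<open>\<bar>y\<bar> \<le> z / 2\<close> the condition \<open>4 * A \<le> z\<^sup>2\<close> keeps
  \<open>z - y\<close> outside the truncation and the exact remainder applies. Otherwise
  \<open>z < 2 * \<bar>y\<bar>\<close>, so the polynomial terms are of order
  \<open>y\<^sup>2\<close>; the fourth power enters only for positive \<open>y\<close>, where the
  barrier may be as large as 1.\<close>

lemma barrier_remainder_bound:
  fixes z y :: real
  assumes A: "0 \<le> A" and z: "1 \<le> z" "4 * A \<le> z\<^sup>2"
  shows "\<bar>z ^ 4 * (barrier A (z - y) - A / z\<^sup>2 - 2 * A * y / z ^ 3)\<bar>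
    \<le> 16 * A * y\<^sup>2 + 16 * (max y 0) ^ 4"
proof -
  let ?L = "z ^ 4 * (barrier A (z - y) - A / z\<^sup>2 - 2 * A * y / z ^ 3)"
  have eq: "?L = z ^ 4 * barrier A (z - y) - A * z\<^sup>2 - 2 * A * y * z"
    using z by (simp add: field_simps power2_eq_square power3_eq_cube power4_eq_xxxx)
  consider "\<bar>y\<bar> \<le> z / 2" | "y < - (z / 2)" | "z / 2 < y" by linarith
  then show ?thesis
  proof cases
    case 1
    have zy: "z / 2 \<le> z - y" using 1 by linarith
    then have sq: "(z / 2)\<^sup>2 \<le> (z - y)\<^sup>2" using z by (intro power_mono) auto
    then have "A \<le> (z - y)\<^sup>2" using z by (simp add: power2_eq_square)
    then have L: "?L = A * y\<^sup>2 * (z * (3 * z - 2 * y) / (z - y)\<^sup>2)" (is "_ = _ * ?q")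
      using zy z by (simp add: barrier_eq inverse_square_remainder)
    have "0 \<le> ?q"
      using 1 z by (intro divide_nonneg_nonneg mult_nonneg_nonneg) auto
    moreover have "?q \<le> 16"
    proof -
      have "z * (3 * z - 2 * y) \<le> z * (4 * z)"
        using 1 z by (intro mult_left_mono) auto
      also have "\<dots> = 16 * (z / 2)\<^sup>2" by (simp add: power2_eq_square)
      also have "\<dots> \<le> 16 * (z - y)\<^sup>2" using sq by simp
      finally show ?thesis using zy z by (simp add: field_simps)
    qed
    ultimately have "0 \<le> A * y\<^sup>2 * ?q" "A * y\<^sup>2 * ?q \<le> A * y\<^sup>2 * 16"
      using A by (auto intro!: mult_left_mono mult_nonneg_nonneg simp del: times_divide_eq_right)
    moreover have "0 \<le> (max y 0) ^ 4" by simp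
    ultimately show ?thesis unfolding L by linarith
  next
    case 2
    have zy: "z \<le> z - y" using 2 z by linarith
    then have sq: "z\<^sup>2 \<le> (z - y)\<^sup>2" using z by (intro power_mono) auto
    have "A \<le> (z - y)\<^sup>2" using z A sq by linarith
    then have "barrier A (z - y) = A / (z - y)\<^sup>2" using zy z by (intro barrier_eq) auto
    also have "\<dots> \<le> A / z\<^sup>2" using A z sq by (intro divide_left_mono mult_pos_pos) auto
    finally have "z ^ 4 * barrier A (z - y) \<le> z ^ 4 * (A / z\<^sup>2)" using z by (intro mult_left_mono) auto
    also have "\<dots> = A * z\<^sup>2" using z by (simp add: field_simps power2_eq_square power4_eq_xxxx)
    finally have "z ^ 4 * barrier A (z - y) \<le> A * z\<^sup>2" .
    moreover have "0 \<le> z ^ 4 * barrier A (z - y)" using A by (simp add: barrier_bounds)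
    moreover have "A * z\<^sup>2 \<le> A * (2 * \<bar>y\<bar>)\<^sup>2" using 2 z A by (intro mult_left_mono power_mono) auto
    moreover have "A * (\<bar>y\<bar> * z) \<le> A * (\<bar>y\<bar> * (2 * \<bar>y\<bar>))" using 2 z A by (intro mult_left_mono) auto
    moreover have "0 \<le> A * (\<bar>y\<bar> * z)" "0 \<le> A * y\<^sup>2" using A z by auto
    moreover have "\<bar>y\<bar> = - y" "max y 0 = 0" using 2 z by auto
    ultimately show ?thesis unfolding eq by (simp add: power2_eq_square abs_le_iff)
  next
    case 3
    have "z ^ 4 * barrier A (z - y) \<le> z ^ 4 * 1" using A z by (intro mult_left_mono barrier_bounds) auto
    also have "\<dots> \<le> (2 * y) ^ 4" using power_mono[of z "2 * y" 4] 3 z by simp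
    finally have "z ^ 4 * barrier A (z - y) \<le> 16 * (max y 0) ^ 4" using 3 z by (simp add: power_mult_distrib)
    moreover have "0 \<le> z ^ 4 * barrier A (z - y)" using A by (simp add: barrier_bounds)
    moreover have "A * z\<^sup>2 \<le> A * (2 * y)\<^sup>2" using 3 z A by (intro mult_left_mono power_mono) auto
    moreover have "A * (y * z) \<le> A * (y * (2 * y))" using 3 z A by (intro mult_left_mono) auto
    moreover have "0 \<le> A * (y * z)" "0 \<le> A * y\<^sup>2" "0 \<le> A * z\<^sup>2" "0 \<le> (max y 0) ^ 4" using A z 3 by auto
    ultimately show ?thesis unfolding eq by (simp add: power2_eq_square abs_le_iff mult.assoc)
  qed
qed

lemma tendsto_barrier_remainder:
  assumes "0 \<le> A"
  shows "((\<lambda>z. z ^ 4 * (barrier A (z - y) - A / z\<^sup>2 - 2 * A * y / z ^ 3)) \<longlongrightarrow> 3 * A * y\<^sup>2) at_top"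
proof -
  have "((\<lambda>z. z * (3 * z - 2 * y) / (z - y)\<^sup>2) \<longlongrightarrow> 3) at_top"
    by real_asymp
  from tendsto_mult[OF tendsto_const[of "A * y\<^sup>2"] this]
  have "((\<lambda>z. A * y\<^sup>2 * (z * (3 * z - 2 * y) / (z - y)\<^sup>2)) \<longlongrightarrow> 3 * A * y\<^sup>2) at_top"
    by (simp add: mult_ac)
  moreover have "\<forall>\<^sub>F z in at_top. A * y\<^sup>2 * (z * (3 * z - 2 * y) / (z - y)\<^sup>2)
      = z ^ 4 * (barrier A (z - y) - A / z\<^sup>2 - 2 * A * y / z ^ 3)"
  proof -
    have "\<forall>\<^sub>F z in at_top. A \<le> (z - y)\<^sup>2" by real_asymp
    then show ?thesis using eventually_gt_at_top[of 0] eventually_gt_at_top[of y]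
      by eventually_elim (simp add: barrier_eq inverse_square_remainder)
  qed
  ultimately show ?thesis by (rule Lim_transform_eventually)
qed

text \<open>A fixed shift does not affect the leading constant, so shifted barriers still give sharp
  bounds.\<close>

lemma tendsto_scaled_barrier: "((\<lambda>x. x\<^sup>2 * barrier A (x + a)) \<longlongrightarrow> A) at_top"
proof -
  have "((\<lambda>x. x\<^sup>2 / (x + a)\<^sup>2) \<longlongrightarrow> 1) at_top" by real_asymp
  from tendsto_mult[OF tendsto_const[of A] this]
  have "((\<lambda>x. A * (x\<^sup>2 / (x + a)\<^sup>2)) \<longlongrightarrow> A) at_top" by simp
  moreover have "\<forall>\<^sub>F x in at_top. A * (x\<^sup>2 / (x + a)\<^sup>2) = x\<^sup>2 * barrier A (x + a)"
  proof -
    have "\<forall>\<^sub>F x in at_top. A \<le> (x + a)\<^sup>2" by real_asymp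
    then show ?thesis using eventually_gt_at_top[of "- a"]
      by eventually_elim (simp add: barrier_eq)
  qed
  ultimately show ?thesis by (rule Lim_transform_eventually)
qed

section \<open>The barrier under one step of the walk\<close>

locale critical_walk = critical_offspring p \<sigma>2 + prob_space \<mu>
  for p :: "nat pmf" and \<sigma>2 :: real and \<mu> :: "real measure" +
  assumes sets_\<mu> [measurable_cong]: "sets \<mu> = sets borel"
    and centred: "has_bochner_integral \<mu> (\<lambda>y. y) 0"
    and second_moment_step: "integrable \<mu> (\<lambda>y. y\<^sup>2)"
    and fourth_moment_step: "integrable \<mu> (\<lambda>y. (max y 0) ^ 4)"
begin

abbreviation (input) \<eta>2 :: real where "\<eta>2 \<equiv> (\<integral>y. y\<^sup>2 \<partial>\<mu>)"

lemma integrable_barrier: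
  assumes "0 \<le> A"
  shows "integrable \<mu> (\<lambda>y. barrier A (z - y))"
  by (rule integrable_const_bound[where B=1]) (use barrier_bounds[OF assms] in auto)

text \<open>Centring lets the linear term \<open>2 * A * y / z ^ 3\<close> be subtracted without
  changing the mean; the remainder is then integrated by dominated convergence.\<close>

lemma barrier_mean_expansion:
  assumes A: "0 \<le> A"
  shows "((\<lambda>z. z ^ 4 * ((\<integral>y. barrier A (z - y) \<partial>\<mu>) - A / z\<^sup>2)) \<longlongrightarrow> 3 * A * \<eta>2) at_top"
proof -
  let ?r = "\<lambda>z y. z ^ 4 * (barrier A (z - y) - A / z\<^sup>2 - 2 * A * y / z ^ 3)"
  have "((\<lambda>z. \<integral>y. ?r z y \<partial>\<mu>) \<longlongrightarrow> (\<integral>y. 3 * A * y\<^sup>2 \<partial>\<mu>)) at_top"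
  proof (rule integral_dominated_convergence_at_top[where w="\<lambda>y. 16 * A * y\<^sup>2 + 16 * (max y 0) ^ 4"])
    have "\<forall>\<^sub>F z::real in at_top. 4 * A \<le> z\<^sup>2" by real_asymp
    then show "\<forall>\<^sub>F z in at_top. AE y in \<mu>. norm (?r z y) \<le> 16 * A * y\<^sup>2 + 16 * (max y 0) ^ 4"
      using eventually_ge_at_top[of 1]
      by eventually_elim (use barrier_remainder_bound[OF A] in auto)
  qed (use second_moment_step fourth_moment_step tendsto_barrier_remainder[OF A] in auto)
  moreover have "(\<integral>y. ?r z y \<partial>\<mu>) = z ^ 4 * ((\<integral>y. barrier A (z - y) \<partial>\<mu>) - A / z\<^sup>2)" for z
    using centred integrable_barrier[OF A, of z]
    by (simp add: has_bochner_integral_iff prob_space)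
  ultimately show ?thesis by (simp only: integral_mult_right_zero)
qed

text \<open>Two corrections of order \<open>z ^ -4\<close> compete: the diffusive gain
  \<open>3 * A * \<eta>2\<close> from the step, and the branching loss
  \<open>\<sigma>2 / 2 * A\<^sup>2\<close> from \<open>hit_prob_expansion\<close> at a mean
  \<open>v z\<close> asymptotic to \<open>A / z\<^sup>2\<close>.\<close>

lemma hit_prob_barrier_expansion:
  assumes A: "0 < A"
  shows "((\<lambda>z. z ^ 4 * (hit_prob p (\<integral>y. barrier A (z - y) \<partial>\<mu>) - A / z\<^sup>2))
    \<longlongrightarrow> A * (3 * \<eta>2 - \<sigma>2 / 2 * A)) at_top"
proof -
  define v where "v z = (\<integral>y. barrier A (z - y) \<partial>\<mu>)" for z
  have 1: "((\<lambda>z. z ^ 4 * (v z - A / z\<^sup>2)) \<longlongrightarrow> 3 * A * \<eta>2) at_top"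
    unfolding v_def using barrier_mean_expansion[of A] A by simp
  \<comment> \<open>Dividing the fourth-order estimate by \<open>z\<^sup>2\<close> leaves the
    leading asymptotics of \<open>v\<close>.\<close>
  have "((\<lambda>z. A + (z ^ 4 * (v z - A / z\<^sup>2)) * (1 / z\<^sup>2)) \<longlongrightarrow> A + 3 * A * \<eta>2 * 0) at_top"
    by (intro tendsto_intros 1) real_asymp
  moreover have "\<forall>\<^sub>F z in at_top. A + (z ^ 4 * (v z - A / z\<^sup>2)) * (1 / z\<^sup>2) = z\<^sup>2 * v z"
    using eventually_gt_at_top[of 0]
    by eventually_elim (simp add: field_simps power2_eq_square power4_eq_xxxx)
  ultimately have 2: "((\<lambda>z. z\<^sup>2 * v z) \<longlongrightarrow> A) at_top"
    using Lim_transform_eventually by force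
  have "((\<lambda>z. z\<^sup>2 * v z * (1 / z\<^sup>2)) \<longlongrightarrow> A * 0) at_top"
    by (intro tendsto_mult 2) real_asymp
  moreover have "\<forall>\<^sub>F z in at_top. z\<^sup>2 * v z * (1 / z\<^sup>2) = v z"
    using eventually_gt_at_top[of 0] by eventually_elim simp
  ultimately have v0: "(v \<longlongrightarrow> 0) at_top"
    using Lim_transform_eventually by force
  have vpos: "\<forall>\<^sub>F z in at_top. 0 < v z"
    using order_tendstoD(1)[OF 2 A] by eventually_elim (simp add: zero_less_mult_iff)
  have "((\<lambda>z. z ^ 4 * (v z - A / z\<^sup>2) - (z\<^sup>2 * v z)\<^sup>2 * ((v z - hit_prob p (v z)) / (v z)\<^sup>2))
      \<longlongrightarrow> 3 * A * \<eta>2 - A\<^sup>2 * (\<sigma>2 / 2)) at_top"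
    by (intro tendsto_intros 1 2 hit_prob_expansion v0 vpos)
  moreover have "\<forall>\<^sub>F z in at_top. z ^ 4 * (v z - A / z\<^sup>2) - (z\<^sup>2 * v z)\<^sup>2 * ((v z - hit_prob p (v z)) / (v z)\<^sup>2)
      = z ^ 4 * (hit_prob p (v z) - A / z\<^sup>2)"
    using vpos
  proof eventually_elim
    case (elim z)
    then have "(z\<^sup>2 * v z)\<^sup>2 * ((v z - hit_prob p (v z)) / (v z)\<^sup>2) = z ^ 4 * (v z - hit_prob p (v z))"
      by (simp add: power_mult_distrib flip: power_mult)
    then show ?case by (simp add: algebra_simps)
  qed
  ultimately have "((\<lambda>z. z ^ 4 * (hit_prob p (v z) - A / z\<^sup>2))
      \<longlongrightarrow> 3 * A * \<eta>2 - A\<^sup>2 * (\<sigma>2 / 2)) at_top"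
    by (rule Lim_transform_eventually)
  then show ?thesis by (simp add: v_def power2_eq_square algebra_simps)
qed

text \<open>For positive \<open>A\<close> the limit in \<open>hit_prob_barrier_expansion\<close>
  changes sign exactly at \<open>6 * \<eta>2 / \<sigma>2\<close>; above this value it is
  negative.\<close>

lemma barrier_eventually_super:
  assumes "6 * \<eta>2 / \<sigma>2 < A"
  shows "\<forall>\<^sub>F z in at_top. hit_prob p (\<integral>y. barrier A (z - y) \<partial>\<mu>) \<le> barrier A z"
proof -
  have "0 \<le> 6 * \<eta>2 / \<sigma>2" using variance_pos by simp
  then have A: "0 < A" using assms by linarith
  have "A * (3 * \<eta>2 - \<sigma>2 / 2 * A) < 0"
    using A assms variance_pos by (auto simp: mult_less_0_iff field_simps)
  from order_tendstoD(2)[OF hit_prob_barrier_expansion[OF A] this]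
  have "\<forall>\<^sub>F z in at_top. z ^ 4 * (hit_prob p (\<integral>y. barrier A (z - y) \<partial>\<mu>) - A / z\<^sup>2) < 0" .
  moreover have "\<forall>\<^sub>F z::real in at_top. A \<le> z\<^sup>2" by real_asymp
  ultimately show ?thesis using eventually_gt_at_top[of 0]
    by eventually_elim (auto simp: mult_less_0_iff barrier_eq)
qed

lemma barrier_eventually_sub:
  assumes "0 < A" "A < 6 * \<eta>2 / \<sigma>2"
  shows "\<forall>\<^sub>F z in at_top. barrier A z \<le> hit_prob p (\<integral>y. barrier A (z - y) \<partial>\<mu>)"
proof -
  have "0 < A * (3 * \<eta>2 - \<sigma>2 / 2 * A)"
    using assms variance_pos by (auto simp: zero_less_mult_iff field_simps)
  from order_tendstoD(1)[OF hit_prob_barrier_expansion[OF assms(1)] this]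
  have "\<forall>\<^sub>F z in at_top. 0 < z ^ 4 * (hit_prob p (\<integral>y. barrier A (z - y) \<partial>\<mu>) - A / z\<^sup>2)" .
  moreover have "\<forall>\<^sub>F z::real in at_top. A \<le> z\<^sup>2" by real_asymp
  ultimately show ?thesis using eventually_gt_at_top[of 0]
    by eventually_elim (auto simp: zero_less_mult_iff barrier_eq)
qed

lemma integral_add_shift:
  "(\<integral>y. f (x - y + a) \<partial>\<mu>) = (\<integral>y. f ((x + a) - y) \<partial>\<mu>)" for f :: "real \<Rightarrow> real"
  by (simp add: algebra_simps)

section \<open>Asymptotics of monotone solutions of the root equation\<close>

context
  fixes w :: "real \<Rightarrow> real"
  assumes w_antimono: "antimono w"
    and w_bounds: "\<And>x. 0 \<le> w x" "\<And>x. w x \<le> 1"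
    and w_neg: "\<And>x. x < 0 \<Longrightarrow> w x = 1"
    and w_eq: "\<And>x. 0 \<le> x \<Longrightarrow> w x = hit_prob p (\<integral>y. w (x - y) \<partial>\<mu>)"
begin

lemma w_measurable [measurable]: "w \<in> borel_measurable borel"
  by (rule borel_measurable_antimono[OF w_antimono])

lemma integrable_w: "integrable \<mu> (\<lambda>y. w (x - y))"
  by (rule integrable_const_bound[where B=1]) (use w_bounds in auto)

lemma mean_w: "0 \<le> (\<integral>y. w (x - y) \<partial>\<mu>)" "(\<integral>y. w (x - y) \<partial>\<mu>) \<le> 1"
  using w_bounds by (auto intro!: integral_le_const integrable_w)

text \<open>The limit \<open>l\<close> of the monotone function \<open>w\<close> satisfies
  \<open>l \<le> hit_prob p l\<close>, which forces \<open>l = 0\<close>.\<close>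

lemma fixed_point_tendsto_0: "(w \<longlongrightarrow> 0) at_top"
proof -
  define l where "l = (INF x. w x)"
  have bdd: "bdd_below (range w)" by (rule bdd_belowI[of _ 0]) (use w_bounds in auto)
  have l: "0 \<le> l" "l \<le> w x" for x
    unfolding l_def using w_bounds bdd by (auto intro!: cINF_greatest cINF_lower)
  have lim: "(w \<longlongrightarrow> l) at_top"
  proof (rule order_tendstoI)
    fix a assume "l < a"
    then obtain x where "w x < a" unfolding l_def by (auto simp: cInf_less_iff bdd)
    show "\<forall>\<^sub>F x in at_top. w x < a"
      using eventually_ge_at_top[of x]
    proof eventually_elim
      case (elim x')
      then have "w x' \<le> w x" by (rule antimonoD[OF w_antimono])
      then show ?case using \<open>w x < a\<close> by simp
    qed
  next
    show "\<forall>\<^sub>F x in at_top. a < w x" if "a < l" for a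
      using less_le_trans[OF that l(2)] by (intro always_eventually allI)
  qed
  have "((\<lambda>x. \<integral>y. w (x - y) \<partial>\<mu>) \<longlongrightarrow> (\<integral>y. l \<partial>\<mu>)) at_top"
  proof (rule integral_dominated_convergence_at_top[where w="\<lambda>_. 1"])
    have "filterlim (\<lambda>x. x - y) at_top at_top" for y :: real by real_asymp
    then show "AE y in \<mu>. ((\<lambda>x. w (x - y)) \<longlongrightarrow> l) at_top"
      by (intro AE_I2 filterlim_compose[OF lim])
  qed (use w_bounds in auto)
  then have mean: "((\<lambda>x. \<integral>y. w (x - y) \<partial>\<mu>) \<longlongrightarrow> l) at_top" by (simp add: prob_space)
  \<comment> \<open>The increment bound together with \<open>hit_prob_le\<close> does the work of
    continuity of \<open>hit_prob p\<close> at \<open>l\<close>.\<close>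
  have bound: "w x - hit_prob p l \<le> (\<integral>y. w (x - y) \<partial>\<mu>) - l" if "0 \<le> x" for x
  proof -
    let ?m = "\<integral>y. w (x - y) \<partial>\<mu>"
    have "l \<le> ?m" using l integrable_w by (intro integral_ge_const) auto
    then have "hit_prob p ?m - hit_prob p l \<le> hit_prob p (?m - l)"
      using l mean_w by (intro hit_prob_diff_le) auto
    also have "\<dots> \<le> ?m - l" using \<open>l \<le> ?m\<close> l mean_w[of x] by (intro hit_prob_le) auto
    finally show ?thesis using w_eq[OF that] by simp
  qed
  have "l - hit_prob p l \<le> l - l"
  proof (rule tendsto_le)
    show "((\<lambda>x. w x - hit_prob p l) \<longlongrightarrow> l - hit_prob p l) at_top" by (intro tendsto_intros lim)
    show "((\<lambda>x. (\<integral>y. w (x - y) \<partial>\<mu>) - l) \<longlongrightarrow> l - l) at_top" by (intro tendsto_intros mean)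
    show "\<forall>\<^sub>F x in at_top. w x - hit_prob p l \<le> (\<integral>y. w (x - y) \<partial>\<mu>) - l"
      using eventually_ge_at_top[of 0] by eventually_elim (rule bound)
  qed simp
  moreover have "l \<le> 1" using l(2)[of 0] w_bounds(2)[of 0] by simp
  ultimately have "l = 0" using hit_prob_less[of l] l(1) by (cases "l = 0") auto
  then show ?thesis using lim by simp
qed

text \<open>Shifting the barrier by the threshold \<open>a\<close> makes it a subsolution wherever
  the equation for \<open>w\<close> holds; for negative \<open>x\<close> the value
  \<open>w x = 1\<close> dominates it.\<close>

lemma fixed_point_lower:
  assumes "0 < A" "A < 6 * \<eta>2 / \<sigma>2"
  obtains a where "\<And>x. barrier A (x + a) \<le> w x"
proof -
  obtain a where a: "\<And>z. a \<le> z \<Longrightarrow> barrier A z \<le> hit_prob p (\<integral>y. barrier A (z - y) \<partial>\<mu>)"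
    using barrier_eventually_sub[OF assms] by (auto simp: eventually_at_top_linorder)
  have "barrier A (x + a) \<le> w x" for x
  proof (rule hit_prob_comparison[of \<mu> "\<lambda>x. barrier A (x + a)" w "{0..}"])
    fix x :: real
    show "barrier A (x + a) \<le> hit_prob p (\<integral>y. barrier A (x - y + a) \<partial>\<mu>)" if "x \<in> {0..}"
      using a[of "x + a"] that by (simp add: integral_add_shift)
    show "barrier A (x + a) \<le> w x" if "x \<notin> {0..}"
      using that w_neg[of x] barrier_bounds[of A] assms by simp
  qed (use barrier_bounds[of A] assms w_bounds w_eq sets_\<mu> prob_space_axioms in auto)
  then show ?thesis using that by blast
qed

text \<open>The supersolution inequality is available only far out. Elsewhere the barrier has to
  dominate \<open>w\<close> directly, which is possible because \<open>w\<close> tends to 0.\<close>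

lemma fixed_point_upper:
  assumes "6 * \<eta>2 / \<sigma>2 < A"
  obtains a where "\<And>x. w x \<le> barrier A (x + a)"
proof -
  have "0 \<le> 6 * \<eta>2 / \<sigma>2" using variance_pos by simp
  then have A: "0 < A" using assms by linarith
  obtain z1 where z1: "\<And>z. z1 \<le> z \<Longrightarrow> hit_prob p (\<integral>y. barrier A (z - y) \<partial>\<mu>) \<le> barrier A z"
    using barrier_eventually_super[OF assms] by (auto simp: eventually_at_top_linorder)
  define z0 where "z0 = max 1 z1"
  \<comment> \<open>\<open>\<delta>\<close> is the least value of \<open>barrier A\<close> on the
    half-line up to \<open>z0\<close>.\<close>
  define \<delta> where "\<delta> = min 1 (A / z0\<^sup>2)"
  have z0: "1 \<le> z0" "z1 \<le> z0" by (auto simp: z0_def)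
  have \<delta>: "0 < \<delta>" using A z0 by (simp add: \<delta>_def)
  have \<delta>_le: "\<delta> \<le> barrier A z" if "z \<le> z0" for z
  proof (cases "z \<le> 0")
    case False
    then have "A / z0\<^sup>2 \<le> A / z\<^sup>2"
      using A that by (intro divide_left_mono power_mono mult_pos_pos) auto
    then have "min 1 (A / z0\<^sup>2) \<le> min 1 (A / z\<^sup>2)" by (intro min.mono) auto
    then show ?thesis using False by (simp add: barrier_def \<delta>_def)
  qed (auto simp: barrier_def \<delta>_def)
  obtain x0 where x0: "\<And>x. x0 \<le> x \<Longrightarrow> w x < \<delta>"
    using order_tendstoD(2)[OF fixed_point_tendsto_0 \<delta>] by (auto simp: eventually_at_top_linorder)
  \<comment> \<open>the threshold \<open>z0\<close> does not depend on the shift, so the barrier can be moved right until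
    \<open>w\<close> is below \<open>\<delta>\<close> wherever the barrier is less than \<open>1\<close>\<close>
  define a where "a = - max 0 x0"
  have "w x \<le> barrier A (x + a)" for x
  proof (rule hit_prob_comparison[of \<mu> w "\<lambda>x. barrier A (x + a)" "{x. z0 \<le> x + a}"])
    fix x :: real
    show "hit_prob p (\<integral>y. barrier A (x - y + a) \<partial>\<mu>) \<le> barrier A (x + a)" if "x \<in> {x. z0 \<le> x + a}"
      using z1[of "x + a"] that z0 by (simp add: integral_add_shift)
    \<comment> \<open>As \<open>a \<le> 0\<close>, such an \<open>x\<close> is at least
      \<open>z0\<close>, hence nonnegative, and \<open>w_eq\<close> applies.\<close>
    show "w x \<le> hit_prob p (\<integral>y. w (x - y) \<partial>\<mu>)" if "x \<in> {x. z0 \<le> x + a}"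
      using that z0 w_eq[of x] by (simp add: a_def)
    show "w x \<le> barrier A (x + a)" if "x \<notin> {x. z0 \<le> x + a}"
    proof (cases "x0 \<le> x")
      case True
      then show ?thesis using x0[OF True] \<delta>_le[of "x + a"] that by simp
    next
      case False
      then have "x + a \<le> 0" by (simp add: a_def)
      then show ?thesis using w_bounds by (simp add: barrier_def)
    qed
  qed (use barrier_bounds[of A] A w_bounds sets_\<mu> prob_space_axioms in auto)
  then show ?thesis using that by blast
qed

theorem fixed_point_asymptotics:
  assumes "0 < \<eta>2"
  shows "((\<lambda>x. x\<^sup>2 * w x) \<longlongrightarrow> 6 * \<eta>2 / \<sigma>2) at_top"
proof (rule order_tendstoI)
  let ?c = "6 * \<eta>2 / \<sigma>2"
  have c: "0 < ?c" using assms variance_pos by simp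
  fix b
  {
    assume "b < ?c"
    \<comment> \<open>\<open>max b 0\<close> keeps \<open>A\<close> positive, as the lower barrier
      requires.\<close>
    then obtain A where A: "max b 0 < A" "A < ?c" using dense[of "max b 0" ?c] c by auto
    obtain a where a: "\<And>x. barrier A (x + a) \<le> w x"
      using fixed_point_lower[of A] A by auto
    have "\<forall>\<^sub>F x in at_top. b < x\<^sup>2 * barrier A (x + a)"
      by (rule order_tendstoD(1)[OF tendsto_scaled_barrier]) (use A in simp)
    then show "\<forall>\<^sub>F x in at_top. b < x\<^sup>2 * w x"
    proof eventually_elim
      case (elim x)
      then show ?case using mult_left_mono[OF a[of x], of "x\<^sup>2"] by simp
    qed
  next
    assume "?c < b"
    then obtain A where A: "?c < A" "A < b" using dense by blast
    obtain a where a: "\<And>x. w x \<le> barrier A (x + a)"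
      using fixed_point_upper[of A] A by auto
    have "\<forall>\<^sub>F x in at_top. x\<^sup>2 * barrier A (x + a) < b"
      by (rule order_tendstoD(2)[OF tendsto_scaled_barrier]) (use A in simp)
    then show "\<forall>\<^sub>F x in at_top. x\<^sup>2 * w x < b"
    proof eventually_elim
      case (elim x)
      then show ?case using mult_left_mono[OF a[of x], of "x\<^sup>2"] by simp
    qed
  }
qed

end

end

section \<open>The recursion at the root\<close>

abbreviation labels :: "(nat list + nat list) set" where
  "labels \<equiv> UNIV <+> - {[]}"

text \<open>A realisation of the whole walk is encoded as one real-valued field indexed by \<open>labels\<close>, so
  that events are transported between the tree and its subtrees by equality of laws.\<close>

abbreviation field_space :: "(nat list + nat list \<Rightarrow> real) measure" where
  "field_space \<equiv> \<Pi>\<^sub>M s\<in>labels. borel"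

definition tree_field ::
    "(nat list \<Rightarrow> 'a \<Rightarrow> nat) \<Rightarrow> (nat list \<Rightarrow> 'a \<Rightarrow> real) \<Rightarrow> 'a \<Rightarrow> nat list + nat list \<Rightarrow> real" where
  "tree_field N X \<omega> = (\<lambda>s\<in>labels. case s of Inl u \<Rightarrow> real (N u \<omega>) | Inr v \<Rightarrow> X v \<omega>)"

text \<open>Expresses \<open>ereal x < maximal_displacement N X \<omega>\<close> through the field
  alone, so that its probability depends only on the law of the field. The first conjunct says that
  \<open>u\<close> is alive.\<close>

definition exceeds :: "real \<Rightarrow> (nat list + nat list \<Rightarrow> real) \<Rightarrow> bool" where
  "exceeds x \<xi> \<longleftrightarrow> (\<exists>u. (\<forall>j<length u. real (u ! j) < \<xi> (Inl (take j u)))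
     \<and> x < (\<Sum>k = 1..length u. \<xi> (Inr (take k u))))"

text \<open>Labels grow at the end, so prepending \<open>i\<close> selects the subtree of the child
  \<open>[i]\<close>. The jump \<open>Inr [i]\<close> of that child is left out and reappears as a
  shift of the threshold.\<close>

definition subfield :: "nat \<Rightarrow> (nat list + nat list \<Rightarrow> real) \<Rightarrow> nat list + nat list \<Rightarrow> real" where
  "subfield i \<xi> = (\<lambda>s\<in>labels. \<xi> (map_sum ((#) i) ((#) i) s))"

definition tree_law :: "nat pmf \<Rightarrow> real measure \<Rightarrow> (nat list + nat list \<Rightarrow> real) measure" where
  "tree_law p \<mu> = (\<Pi>\<^sub>M s\<in>labels. case s of Inl u \<Rightarrow> distr (measure_pmf p) borel real | Inr v \<Rightarrow> \<mu>)"

section \<open>The walk read off its field\<close>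

lemma mem_labels [simp]: "Inl u \<in> labels" "Inr v \<in> labels \<longleftrightarrow> v \<noteq> []"
  by auto

lemma tree_field_simps [simp]:
  "tree_field N X \<omega> (Inl u) = real (N u \<omega>)"
  "v \<noteq> [] \<Longrightarrow> tree_field N X \<omega> (Inr v) = X v \<omega>"
  by (simp_all add: tree_field_def)

lemma subfield_simps [simp]:
  "subfield i \<xi> (Inl u) = \<xi> (Inl (i # u))"
  "v \<noteq> [] \<Longrightarrow> subfield i \<xi> (Inr v) = \<xi> (Inr (i # v))"
  by (simp_all add: subfield_def)

lemma mem_generation_iff:
  "u \<in> generation N n \<omega> \<longleftrightarrow> length u = n \<and> (\<forall>j<n. u ! j < N (take j u) \<omega>)"
proof (induction n arbitrary: u)
  case (Suc n)
  show ?case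
  proof (cases u rule: rev_cases)
    case (snoc v i)
    then have "u \<in> generation N (Suc n) \<omega> \<longleftrightarrow> v \<in> generation N n \<omega> \<and> i < N v \<omega>" by auto
    also have "\<dots> \<longleftrightarrow> length u = Suc n \<and> (\<forall>j<Suc n. u ! j < N (take j u) \<omega>)"
      unfolding Suc by (auto simp: snoc nth_append less_Suc_eq)
    finally show ?thesis .
  qed auto
qed auto

lemma less_maximal_displacement_iff:
  "ereal x < maximal_displacement N X \<omega> \<longleftrightarrow> exceeds x (tree_field N X \<omega>)"
proof -
  have "(\<Sum>k = 1..length u. tree_field N X \<omega> (Inr (take k u))) = position X u \<omega>" for u
    unfolding position_def by (intro sum.cong refl tree_field_simps) auto
  then show ?thesis
    unfolding maximal_displacement_def less_SUP_iff exceeds_def Bex_def mem_generation_iff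
    by (simp del: sum.cl_ivl_Suc One_nat_def)
qed

lemma exceeds_antimono: "exceeds y \<xi> \<Longrightarrow> x \<le> y \<Longrightarrow> exceeds x \<xi>"
  unfolding exceeds_def by (meson le_less_trans)

lemma exceeds_neg: "x < 0 \<Longrightarrow> exceeds x \<xi>"
  unfolding exceeds_def by (intro exI[of _ "[]"]) auto

text \<open>For \<open>x \<ge> 0\<close> the root is no witness, so a witness has the form
  \<open>i # v\<close>; its first jump moves into the threshold and \<open>v\<close> is a witness in
  the subfield.\<close>

lemma exceeds_iff_child:
  assumes "0 \<le> x"
  shows "exceeds x \<xi> \<longleftrightarrow> (\<exists>i. real i < \<xi> (Inl []) \<and> exceeds (x - \<xi> (Inr [i])) (subfield i \<xi>))"
proof -
  let ?E = "\<lambda>u. (\<forall>j<length u. real (u ! j) < \<xi> (Inl (take j u)))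
     \<and> x < (\<Sum>k = 1..length u. \<xi> (Inr (take k u)))"
  have Nil: "\<not> ?E []" using assms by simp
  have Cons: "?E (i # v) \<longleftrightarrow> real i < \<xi> (Inl []) \<and>
     (\<forall>j<length v. real (v ! j) < subfield i \<xi> (Inl (take j v))) \<and>
     x - \<xi> (Inr [i]) < (\<Sum>k = 1..length v. subfield i \<xi> (Inr (take k v)))" for i v
  proof -
    have "(\<Sum>k = 1..length (i # v). \<xi> (Inr (take k (i # v))))
        = \<xi> (Inr [i]) + (\<Sum>k = 1..length v. \<xi> (Inr (i # take k v)))"
      by (simp add: sum.atLeast_Suc_atMost sum.atLeast_Suc_atMost_Suc_shift del: sum.cl_ivl_Suc)
    also have "(\<Sum>k = 1..length v. \<xi> (Inr (i # take k v))) = (\<Sum>k = 1..length v. subfield i \<xi> (Inr (take k v)))"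
      by (intro sum.cong refl subfield_simps(2)[symmetric]) auto
    finally have sum: "(\<Sum>k = 1..length (i # v). \<xi> (Inr (take k (i # v))))
        = \<xi> (Inr [i]) + (\<Sum>k = 1..length v. subfield i \<xi> (Inr (take k v)))" .
    have "(\<forall>j<length (i # v). real ((i # v) ! j) < \<xi> (Inl (take j (i # v))))
        \<longleftrightarrow> real i < \<xi> (Inl []) \<and> (\<forall>j<length v. real (v ! j) < subfield i \<xi> (Inl (take j v)))"
      by (simp add: All_less_Suc2)
    then show ?thesis unfolding sum by (simp only: conj_assoc diff_less_eq add.commute)
  qed
  have "exceeds x \<xi> \<longleftrightarrow> (\<exists>i v. ?E (i # v))"
  proof -
    have "\<exists>i v. u = i # v" if "?E u" for u using Nil that by (cases u) auto
    then show ?thesis unfolding exceeds_def by blast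
  qed
  then show ?thesis unfolding Cons exceeds_def by auto
qed

lemma measurable_label [measurable]:
  "(\<lambda>\<xi>. \<xi> (Inl u)) \<in> borel_measurable field_space"
  "v \<noteq> [] \<Longrightarrow> (\<lambda>\<xi>. \<xi> (Inr v)) \<in> borel_measurable field_space"
  by (auto intro!: measurable_component_singleton)

text \<open>Joint measurability is needed because the threshold in \<open>exceeds_iff_child\<close>
  is itself random. It holds since there are only countably many labels.\<close>

lemma measurable_exceeds [measurable]:
  "Measurable.pred (borel \<Otimes>\<^sub>M field_space) (\<lambda>(x, \<xi>). exceeds x \<xi>)"
proof -
  have [measurable]: "(\<lambda>z. \<Sum>k = 1..length u. snd z (Inr (take k u))) \<in> borel_measurable (borel \<Otimes>\<^sub>M field_space)" for u :: "nat list"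
    by (intro borel_measurable_sum measurable_compose[OF measurable_snd measurable_label(2)]) auto
  show ?thesis unfolding exceeds_def case_prod_beta by measurable
qed

lemma measurable_subfield [measurable]: "subfield i \<in> measurable field_space field_space"
  unfolding subfield_def
  by (intro measurable_restrict measurable_component_singleton) auto

text \<open>By injectivity the singletons \<open>{f j}\<close> are disjoint blocks of the original
  family.\<close>

lemma (in prob_space) indep_vars_reindex_inj:
  assumes "indep_vars (\<lambda>_. M') Y I" "inj_on f J" "f ` J \<subseteq> I"
  shows "indep_vars (\<lambda>_. M') (\<lambda>j. Y (f j)) J"
proof -
  have "indep_vars (\<lambda>j. \<Pi>\<^sub>M i\<in>{f j}. M') (\<lambda>j \<omega>. restrict (\<lambda>i. Y i \<omega>) {f j}) J"
    using assms(2,3) by (intro indep_vars_restrict[OF assms(1)]) (auto simp: disjoint_family_on_def inj_on_def)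
  then have "indep_vars (\<lambda>_. M') (\<lambda>j \<omega>. (restrict (\<lambda>i. Y i \<omega>) {f j}) (f j)) J"
    by (rule indep_vars_compose2) auto
  then show ?thesis by simp
qed

section \<open>Law and independence of the subtrees\<close>

context branching_random_walk
begin

lemma sets_step [measurable_cong]: "sets \<mu> = sets borel"
  using step_law[of "[0]"] by (metis list.simps(3) sets_distr)

lemma prob_space_step: "prob_space \<mu>"
  using prob_space_distr[OF step_measurable[of "[0]"]] step_law[of "[0]"] by simp

abbreviation label_value :: "nat list + nat list \<Rightarrow> 'a \<Rightarrow> real" where
  "label_value s \<equiv> (case s of Inl u \<Rightarrow> (\<lambda>\<omega>. real (N u \<omega>)) | Inr v \<Rightarrow> X v)"

lemma measurable_label_value: "s \<in> labels \<Longrightarrow> label_value s \<in> borel_measurable P"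
  using offspring_measurable step_measurable
  by (auto split: sum.split intro!: measurable_compose[OF offspring_measurable])

lemma tree_field_eq: "tree_field N X = (\<lambda>\<omega>. \<lambda>s\<in>labels. label_value s \<omega>)"
  by (auto simp: tree_field_def fun_eq_iff split: sum.split)

lemma measurable_tree_field [measurable]: "tree_field N X \<in> measurable P field_space"
  unfolding tree_field_eq by (intro measurable_restrict measurable_label_value)

text \<open>Joint independence means that the joint law is a product. Only \<open>p\<close> and
  \<open>\<mu>\<close> enter the right-hand side, so all walks with these laws share their overshoot
  probabilities.\<close>

lemma distr_tree_field: "distr P field_space (tree_field N X) = tree_law p \<mu>"
proof -
  have "distr P borel (label_value s)
      = (case s of Inl u \<Rightarrow> distr (measure_pmf p) borel real | Inr v \<Rightarrow> \<mu>)" if "s \<in> labels" for s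
  proof (cases s)
    case (Inl u)
    have "distr P borel (\<lambda>\<omega>. real (N u \<omega>)) = distr (distr P (count_space UNIV) (N u)) borel real"
      using offspring_measurable by (subst distr_distr) (auto simp: comp_def)
    then show ?thesis by (simp add: Inl offspring_law)
  next
    case (Inr v)
    then show ?thesis using that step_law[of v] by auto
  qed
  then have "(\<Pi>\<^sub>M s\<in>labels. distr P borel (label_value s)) = tree_law p \<mu>"
    unfolding tree_law_def by (intro PiM_cong) auto
  moreover have "distr P field_space (tree_field N X) = (\<Pi>\<^sub>M s\<in>labels. distr P borel (label_value s))"
    unfolding tree_field_eq
    by (rule indep_vars_iff_distr_eq_PiM'[THEN iffD1, OF _ _ independence])
      (auto intro: measurable_label_value)
  ultimately show ?thesis by simp
qed

lemma prob_exceeds: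
  "prob {\<omega> \<in> space P. exceeds x (tree_field N X \<omega>)} = measure (tree_law p \<mu>) {\<xi> \<in> space field_space. exceeds x \<xi>}"
  unfolding distr_tree_field[symmetric]
  by (subst measure_distr) (auto intro!: arg_cong[where f=prob] dest: measurable_space[OF measurable_tree_field])

text \<open>Prepending \<open>i\<close> is injective on labels, so the families below the label
  \<open>[i]\<close> form a walk with the same laws, whether or not that child is born.\<close>

lemma subtree: "branching_random_walk P p \<mu> (\<lambda>u. N (i # u)) (\<lambda>v. X (i # v))"
proof
  let ?f = "map_sum ((#) i) ((#) i)"
  have "indep_vars (\<lambda>_. borel) (\<lambda>s. label_value (?f s)) labels"
    by (rule indep_vars_reindex_inj[OF independence])
      (auto simp: inj_on_def)
  also have "(\<lambda>s. label_value (?f s)) = (\<lambda>s. case s of Inl u \<Rightarrow> (\<lambda>\<omega>. real (N (i # u) \<omega>)) | Inr v \<Rightarrow> X (i # v))"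
    by (auto simp: fun_eq_iff split: sum.split)
  finally show "indep_vars (\<lambda>_. borel)
      (\<lambda>s. case s of Inl u \<Rightarrow> (\<lambda>\<omega>. real (N (i # u) \<omega>)) | Inr v \<Rightarrow> X (i # v)) labels" .
qed (use offspring_measurable offspring_law step_measurable step_law in auto)

lemma subfield_tree_field:
  "subfield i (tree_field N X \<omega>) = tree_field (\<lambda>u. N (i # u)) (\<lambda>v. X (i # v)) \<omega>"
  by (auto simp: subfield_def tree_field_def fun_eq_iff split: sum.split)

text \<open>The strict inequality in \<open>exceeds\<close> lets the recursion hold surely, without knowing that the
  supremum defining the maximal displacement is attained.\<close>

definition overshoot :: "real \<Rightarrow> real" where
  "overshoot x = prob {\<omega> \<in> space P. exceeds x (tree_field N X \<omega>)}"

lemma sets_exceeds [measurable]: "{\<omega> \<in> space P. exceeds x (tree_field N X \<omega>)} \<in> events"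
  using measurable_exceeds by measurable

lemma antimono_overshoot: "antimono overshoot"
  unfolding overshoot_def
  by (auto intro!: antimonoI finite_measure_mono intro: exceeds_antimono)

lemma measurable_overshoot [measurable]: "overshoot \<in> borel_measurable borel"
  by (rule borel_measurable_antimono[OF antimono_overshoot])

lemma overshoot_neg: "x < 0 \<Longrightarrow> overshoot x = 1"
  by (simp add: overshoot_def exceeds_neg prob_space)

text \<open>The two variables depend on disjoint sets of labels. The jump is kept as a field over a
  single label to match the form of \<open>indep_var_restrict\<close>.\<close>

lemma indep_first_jump_subtree:
  "indep_var (\<Pi>\<^sub>M s\<in>{Inr [i]}. borel) (\<lambda>\<omega>. \<lambda>s\<in>{Inr [i]}. X [i] \<omega>)
     field_space (\<lambda>\<omega>. subfield i (tree_field N X \<omega>))"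
proof -
  let ?f = "map_sum ((#) i) ((#) i)"
  have "indep_var (\<Pi>\<^sub>M s\<in>{Inr [i]}. borel) (\<lambda>\<omega>. restrict (\<lambda>s. label_value s \<omega>) {Inr [i]})
      (\<Pi>\<^sub>M s\<in>?f ` labels. borel) (\<lambda>\<omega>. restrict (\<lambda>s. label_value s \<omega>) (?f ` labels))"
    by (rule indep_var_restrict[OF independence]) auto
  then have "indep_var (\<Pi>\<^sub>M s\<in>{Inr [i]}. borel) (id \<circ> (\<lambda>\<omega>. restrict (\<lambda>s. label_value s \<omega>) {Inr [i]}))
      field_space ((\<lambda>\<zeta>. \<lambda>s\<in>labels. \<zeta> (?f s)) \<circ> (\<lambda>\<omega>. restrict (\<lambda>s. label_value s \<omega>) (?f ` labels)))"
    by (rule indep_var_compose)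
      (auto intro!: measurable_restrict measurable_component_singleton)
  also have "id \<circ> (\<lambda>\<omega>. restrict (\<lambda>s. label_value s \<omega>) {Inr [i]}) = (\<lambda>\<omega>. \<lambda>s\<in>{Inr [i]}. X [i] \<omega>)"
    by (auto simp: fun_eq_iff)
  also have "(\<lambda>\<zeta>. \<lambda>s\<in>labels. \<zeta> (?f s)) \<circ> (\<lambda>\<omega>. restrict (\<lambda>s. label_value s \<omega>) (?f ` labels))
      = (\<lambda>\<omega>. subfield i (tree_field N X \<omega>))"
    by (auto simp: fun_eq_iff subfield_def tree_field_eq)
  finally show ?thesis .
qed

text \<open>Given the first jump \<open>y\<close>, the subtree is a fresh copy of the walk facing
  the threshold \<open>x - y\<close>; the product form of the joint law allows integration over
  \<open>y\<close>.\<close>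

lemma prob_child_exceeds:
  "prob {\<omega> \<in> space P. exceeds (x - X [i] \<omega>) (subfield i (tree_field N X \<omega>))}
    = (\<integral>y. overshoot (x - y) \<partial>\<mu>)"
proof -
  interpret sub: branching_random_walk P p \<mu> "\<lambda>u. N (i # u)" "\<lambda>v. X (i # v)" by (rule subtree)
  interpret \<mu>: prob_space \<mu> by (rule prob_space_step)
  let ?W = "tree_law p \<mu>" and ?S = "\<Pi>\<^sub>M s\<in>{Inr [i]}. borel"
  let ?J = "\<lambda>\<omega>. \<lambda>s\<in>{Inr [i] :: nat list + nat list}. X [i] \<omega>"
  have [measurable]: "X [i] \<in> borel_measurable P" by (simp add: step_measurable)
  have J [measurable]: "?J \<in> measurable P ?S" by measurable
  have [measurable]: "(\<lambda>\<zeta>. \<zeta> (Inr [i])) \<in> borel_measurable ?S" by (intro measurable_component_singleton) simp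
  have W: "distr P field_space (\<lambda>\<omega>. subfield i (tree_field N X \<omega>)) = ?W"
    using sub.distr_tree_field by (simp add: subfield_tree_field)
  have sets_W [measurable_cong]: "sets ?W = sets field_space"
    unfolding W[symmetric] by simp
  interpret W: prob_space ?W
    unfolding W[symmetric] by (rule prob_space_distr) measurable
  define D where "D = distr P ?S ?J"
  have [measurable_cong]: "sets D = sets ?S" by (simp add: D_def)
  let ?B = "{z \<in> space (D \<Otimes>\<^sub>M ?W). exceeds (x - fst z (Inr [i])) (snd z)}"
  have B: "?B \<in> sets (D \<Otimes>\<^sub>M ?W)"
    using measurable_exceeds by measurable
  have joint: "D \<Otimes>\<^sub>M ?W = distr P (?S \<Otimes>\<^sub>M field_space) (\<lambda>\<omega>. (?J \<omega>, subfield i (tree_field N X \<omega>)))"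
    using indep_first_jump_subtree[of i] unfolding indep_var_distribution_eq by (simp add: W D_def)
  have "emeasure P {\<omega> \<in> space P. exceeds (x - X [i] \<omega>) (subfield i (tree_field N X \<omega>))}
      = emeasure (D \<Otimes>\<^sub>M ?W) ?B"
  proof -
    have "emeasure (D \<Otimes>\<^sub>M ?W) ?B = emeasure P ((\<lambda>\<omega>. (?J \<omega>, subfield i (tree_field N X \<omega>))) -` ?B \<inter> space P)"
      using B unfolding joint by (subst emeasure_distr) auto
    moreover have "(\<lambda>\<omega>. (?J \<omega>, subfield i (tree_field N X \<omega>))) -` ?B \<inter> space P
        = {\<omega> \<in> space P. exceeds (x - X [i] \<omega>) (subfield i (tree_field N X \<omega>))}"
      using measurable_space[OF measurable_compose[OF measurable_tree_field measurable_subfield[of i]]]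
        measurable_space[OF J]
      by (auto simp: joint space_pair_measure)
    ultimately show ?thesis by simp
  qed
  also have "\<dots> = (\<integral>\<^sup>+ \<zeta>. emeasure ?W (Pair \<zeta> -` ?B) \<partial>D)"
    by (rule W.emeasure_pair_measure_alt[OF B])
  also have "\<dots> = (\<integral>\<^sup>+ \<zeta>. ennreal (overshoot (x - \<zeta> (Inr [i]))) \<partial>D)"
  proof (rule nn_integral_cong)
    fix \<zeta> assume "\<zeta> \<in> space D"
    then have "Pair \<zeta> -` ?B = {\<xi> \<in> space field_space. exceeds (x - \<zeta> (Inr [i])) \<xi>}"
      using sets_eq_imp_space_eq[OF sets_W] by (auto simp: space_pair_measure)
    then show "emeasure ?W (Pair \<zeta> -` ?B) = ennreal (overshoot (x - \<zeta> (Inr [i])))"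
      by (simp add: overshoot_def prob_exceeds W.emeasure_eq_measure)
  qed
  also have "\<dots> = (\<integral>\<^sup>+ \<omega>. ennreal (overshoot (x - X [i] \<omega>)) \<partial>P)"
    unfolding D_def by (subst nn_integral_distr) auto
  also have "\<dots> = (\<integral>\<^sup>+ y. ennreal (overshoot (x - y)) \<partial>distr P borel (X [i]))"
    by (subst nn_integral_distr) auto
  also have "\<dots> = (\<integral>\<^sup>+ y. ennreal (overshoot (x - y)) \<partial>\<mu>)" by (simp add: step_law)
  also have "\<dots> = ennreal (\<integral>y. overshoot (x - y) \<partial>\<mu>)"
    by (intro nn_integral_eq_integral \<mu>.integrable_const_bound[where B=1])
      (auto simp: overshoot_def)
  finally show ?thesis
    by (simp add: emeasure_eq_measure overshoot_def integral_nonneg_AE)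
qed

text \<open>\<open>None\<close> stands for the offspring number of the root and
  \<open>Some i\<close> for the success of child \<open>i\<close>. Success is defined for unborn
  children too, so it does not involve the offspring number of the root.\<close>

lemma indep_offspring_children:
  "indep_vars (\<lambda>_. borel) (\<lambda>j \<omega>. case j of None \<Rightarrow> real (N [] \<omega>)
     | Some i \<Rightarrow> of_bool (exceeds (x - X [i] \<omega>) (subfield i (tree_field N X \<omega>)))) UNIV"
proof -
  \<comment> \<open>Disjoint blocks of labels: the offspring number of the root, and for each
    \<open>i\<close> all labels that start with \<open>i\<close>.\<close>
  define K :: "nat option \<Rightarrow> (nat list + nat list) set"
    where "K j = (case j of None \<Rightarrow> {Inl []} | Some i \<Rightarrow> range (\<lambda>u. Inl (i # u)) \<union> range (\<lambda>v. Inr (i # v)))" for j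
  define G :: "nat option \<Rightarrow> (nat list + nat list \<Rightarrow> real) \<Rightarrow> real"
    where "G j \<zeta> = (case j of None \<Rightarrow> \<zeta> (Inl []) | Some i \<Rightarrow> of_bool (exceeds (x - \<zeta> (Inr [i])) (subfield i \<zeta>)))" for j \<zeta>
  have "indep_vars (\<lambda>j. \<Pi>\<^sub>M s\<in>K j. borel) (\<lambda>j \<omega>. restrict (\<lambda>s. label_value s \<omega>) (K j)) UNIV"
    by (rule indep_vars_restrict[OF independence])
      (auto simp: K_def disjoint_family_on_def split: option.splits)
  then have "indep_vars (\<lambda>_. borel) (\<lambda>j \<omega>. G j (restrict (\<lambda>s. label_value s \<omega>) (K j))) UNIV"
  proof (rule indep_vars_compose2)
    fix j
    show "G j \<in> borel_measurable (\<Pi>\<^sub>M s\<in>K j. borel)"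
    proof (cases j)
      case None
      then have "G j = (\<lambda>\<zeta>. \<zeta> (Inl []))" "K j = {Inl []}" by (auto simp: G_def K_def)
      then show ?thesis by (auto intro: measurable_component_singleton)
    next
      case (Some i)
      have [measurable]: "(\<lambda>\<zeta>. \<zeta> (Inr [i])) \<in> borel_measurable (\<Pi>\<^sub>M s\<in>K j. borel)"
        by (intro measurable_component_singleton) (auto simp: K_def Some)
      have [measurable]: "subfield i \<in> measurable (\<Pi>\<^sub>M s\<in>K j. borel) field_space"
        unfolding subfield_def
        by (intro measurable_restrict measurable_component_singleton) (auto simp: K_def Some)
      have [measurable]: "Measurable.pred (\<Pi>\<^sub>M s\<in>K j. borel) (\<lambda>\<zeta>. exceeds (x - \<zeta> (Inr [i])) (subfield i \<zeta>))"
        using measurable_exceeds by measurable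
      have "G j = (\<lambda>\<zeta>. of_bool (exceeds (x - \<zeta> (Inr [i])) (subfield i \<zeta>)))"
        by (simp add: G_def Some fun_eq_iff)
      then show ?thesis by simp
    qed
  qed
  also have "?this \<longleftrightarrow> ?thesis"
  proof (rule indep_vars_cong[OF refl _ refl], rule ext)
    fix j \<omega>
    show "G j (restrict (\<lambda>s. label_value s \<omega>) (K j)) = (case j of None \<Rightarrow> real (N [] \<omega>)
     | Some i \<Rightarrow> of_bool (exceeds (x - X [i] \<omega>) (subfield i (tree_field N X \<omega>))))"
    proof (cases j)
      case (Some i)
      have Inl_mem: "Inl (i # u) \<in> K j" and Inr_mem: "Inr (i # v) \<in> K j" for u v
        by (auto simp: K_def Some)
      have "subfield i (restrict (\<lambda>s. label_value s \<omega>) (K j)) = subfield i (tree_field N X \<omega>)"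
        using Inl_mem Inr_mem by (auto simp: subfield_def tree_field_eq fun_eq_iff)
      then show ?thesis using Inr_mem[of "[]"] by (simp add: G_def Some)
    qed (simp add: G_def K_def)
  qed
  finally show ?thesis .
qed

text \<open>Given \<open>k\<close> children, all of them miss with probability
  \<open>(1 - v) ^ k\<close>, where \<open>v\<close> is the success probability of one child;
  summing over \<open>k\<close> gives the complement of \<open>overshoot x\<close>.\<close>

lemma overshoot_eq:
  assumes "0 \<le> x"
  shows "overshoot x = hit_prob p (\<integral>y. overshoot (x - y) \<partial>\<mu>)"
proof -
  define v where "v = (\<integral>y. overshoot (x - y) \<partial>\<mu>)"
  define H where "H i \<omega> = exceeds (x - X [i] \<omega>) (subfield i (tree_field N X \<omega>))" for i \<omega>
  define Z where "Z j \<omega> = (case j of None \<Rightarrow> real (N [] \<omega>) | Some i \<Rightarrow> of_bool (H i \<omega>))" for j \<omega>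
  interpret \<mu>: prob_space \<mu> by (rule prob_space_step)
  have v: "0 \<le> v" "v \<le> 1"
    unfolding v_def
    by (auto simp: overshoot_def intro!: \<mu>.integral_le_const \<mu>.integrable_const_bound[where B=1])
  have [measurable]: "N u \<in> measurable P (count_space UNIV)" "X [i] \<in> borel_measurable P" for u i
    by (auto intro: offspring_measurable step_measurable)
  have [measurable]: "Measurable.pred P (H i)" for i
    unfolding H_def using measurable_exceeds by measurable
  have indep: "indep_vars (\<lambda>_. borel) Z UNIV"
    using indep_offspring_children[of x] unfolding Z_def H_def .
  have miss: "prob {\<omega> \<in> space P. \<not> H i \<omega>} = 1 - v" for i
    using prob_child_exceeds[of x i] by (subst prob_neg) (auto simp: v_def H_def)
  have "prob {\<omega> \<in> space P. N [] \<omega> = k \<and> (\<forall>i<k. \<not> H i \<omega>)} = (1 - v) ^ k * pmf p k" for k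
  proof -
    \<comment> \<open>The value 0 of the indicator encodes a miss.\<close>
    define A :: "nat option \<Rightarrow> real set" where "A j = (case j of None \<Rightarrow> {real k} | Some i \<Rightarrow> {0})" for j
    have "prob (\<Inter>j\<in>insert None (Some ` {..<k}). Z j -` A j \<inter> space P)
        = (\<Prod>j\<in>insert None (Some ` {..<k}). prob (Z j -` A j \<inter> space P))"
      by (rule indep_varsD[OF indep]) (auto simp: A_def split: option.split)
    also have "(\<Inter>j\<in>insert None (Some ` {..<k}). Z j -` A j \<inter> space P)
        = {\<omega> \<in> space P. N [] \<omega> = k \<and> (\<forall>i<k. \<not> H i \<omega>)}"
      by (auto simp: A_def Z_def)
    also have "(\<Prod>j\<in>insert None (Some ` {..<k}). prob (Z j -` A j \<inter> space P))
        = prob (Z None -` A None \<inter> space P) * (\<Prod>i<k. prob (Z (Some i) -` A (Some i) \<inter> space P))"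
      by (subst prod.insert) (auto simp: prod.reindex)
    also have "Z None -` A None \<inter> space P = N [] -` {k} \<inter> space P"
      by (auto simp: A_def Z_def)
    also have "prob \<dots> = pmf p k"
      using measure_distr[of "N []" P "count_space UNIV" "{k}"]
      by (simp add: offspring_law measure_pmf_single)
    also have "(\<Prod>i<k. prob (Z (Some i) -` A (Some i) \<inter> space P)) = (\<Prod>i<k. 1 - v)"
    proof (rule prod.cong[OF refl])
      fix i
      have "Z (Some i) -` A (Some i) \<inter> space P = {\<omega> \<in> space P. \<not> H i \<omega>}"
        by (auto simp: A_def Z_def)
      then show "prob (Z (Some i) -` A (Some i) \<inter> space P) = 1 - v" by (simp add: miss)
    qed
    finally show ?thesis by simp
  qed
  moreover have "(\<lambda>k. prob {\<omega> \<in> space P. N [] \<omega> = k \<and> (\<forall>i<k. \<not> H i \<omega>)})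
      sums prob (\<Union>k. {\<omega> \<in> space P. N [] \<omega> = k \<and> (\<forall>i<k. \<not> H i \<omega>)})"
    by (rule finite_measure_UNION) (auto simp: disjoint_family_on_def)
  moreover have "(\<Union>k. {\<omega> \<in> space P. N [] \<omega> = k \<and> (\<forall>i<k. \<not> H i \<omega>)})
      = {\<omega> \<in> space P. \<not> exceeds x (tree_field N X \<omega>)}"
    by (auto simp: exceeds_iff_child[OF assms] H_def)
  ultimately have "(\<lambda>k. (1 - v) ^ k * pmf p k) sums (1 - overshoot x)"
    by (simp add: overshoot_def prob_neg)
  then have "has_bochner_integral (measure_pmf p) (\<lambda>k. (1 - v) ^ k) (1 - overshoot x)"
    using v by (intro has_bochner_integral_pmf_nat) auto
  then show ?thesis
    unfolding hit_prob_def v_def[symmetric] by (simp add: has_bochner_integral_iff)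
qed

section \<open>From the strict to the weak inequality\<close>

lemma maximal_displacement_ge_iff:
  "ereal x \<le> maximal_displacement N X \<omega> \<longleftrightarrow> (\<forall>n. exceeds (x - 1 / real (Suc n)) (tree_field N X \<omega>))"
proof
  assume le: "ereal x \<le> maximal_displacement N X \<omega>"
  show "\<forall>n. exceeds (x - 1 / real (Suc n)) (tree_field N X \<omega>)"
  proof
    fix n
    have "ereal (x - 1 / real (Suc n)) < ereal x" by simp
    then show "exceeds (x - 1 / real (Suc n)) (tree_field N X \<omega>)"
      using le less_le_trans by (metis less_maximal_displacement_iff)
  qed
next
  assume *: "\<forall>n. exceeds (x - 1 / real (Suc n)) (tree_field N X \<omega>)"
  show "ereal x \<le> maximal_displacement N X \<omega>"
  proof (rule ccontr)
    assume "\<not> ?thesis"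
    then obtain r where r: "maximal_displacement N X \<omega> < ereal r" "ereal r < ereal x"
      using ereal_dense2[of "maximal_displacement N X \<omega>" "ereal x"] by (auto simp: not_le)
    then obtain n where "1 / real (Suc n) < x - r" using nat_approx_posE[of "x - r"] by auto
    then have "exceeds r (tree_field N X \<omega>)"
      using *[rule_format, of n] by (rule_tac exceeds_antimono) auto
    then show False using r(1) by (simp add: less_maximal_displacement_iff[symmetric])
  qed
qed

text \<open>The countable intersection in \<open>maximal_displacement_ge_iff\<close> makes the event
  measurable, and its index 0 gives the threshold \<open>x - 1\<close>. A unit gap between the
  bounds is harmless in the limit.\<close>

lemma prob_maximal_displacement_ge:
  "overshoot x \<le> prob {\<omega> \<in> space P. maximal_displacement N X \<omega> \<ge> ereal x}"
  "prob {\<omega> \<in> space P. maximal_displacement N X \<omega> \<ge> ereal x} \<le> overshoot (x - 1)"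
proof -
  have "{\<omega> \<in> space P. maximal_displacement N X \<omega> \<ge> ereal x} \<in> events"
    unfolding maximal_displacement_ge_iff by (rule sets.sets_Collect_countable_All) (rule sets_exceeds)
  then show "overshoot x \<le> prob {\<omega> \<in> space P. maximal_displacement N X \<omega> \<ge> ereal x}"
    unfolding overshoot_def by (rule finite_measure_mono[rotated]) (auto simp: less_maximal_displacement_iff[symmetric])
  show "prob {\<omega> \<in> space P. maximal_displacement N X \<omega> \<ge> ereal x} \<le> overshoot (x - 1)"
    unfolding overshoot_def
    by (rule finite_measure_mono[OF _ sets_exceeds]) (auto simp: maximal_displacement_ge_iff dest: spec[of _ 0])
qed

end

theorem theorem1p3:
  fixes P :: "'a measure" and p :: "nat pmf" and \<mu> :: "real measure"
    and N :: "nat list \<Rightarrow> 'a \<Rightarrow> nat" and X :: "nat list \<Rightarrow> 'a \<Rightarrow> real"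
  assumes "branching_random_walk P p \<mu> N X"
    and "(\<lambda>k. real k * pmf p k) sums 1"
    and "pmf p 1 < 1"
    and "has_bochner_integral \<mu> (\<lambda>x. x) 0"
    and "prob_space.variance \<mu> (\<lambda>x. x) > 0"
    and "summable (\<lambda>k. (real k)\<^sup>2 * pmf p k)"
    and "integrable \<mu> (\<lambda>x. x\<^sup>2)"
    and "integrable \<mu> (\<lambda>x. (max x 0) ^ 4)"
  shows "((\<lambda>x::real. x\<^sup>2 * measure P {\<omega> \<in> space P. maximal_displacement N X \<omega> \<ge> ereal x})
    \<longlongrightarrow> 6 * (\<integral>x. x\<^sup>2 \<partial>\<mu>) / ((\<Sum>k. (real k)\<^sup>2 * pmf p k) - 1)) at_top"
proof -
  interpret branching_random_walk P p \<mu> N X by fact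
  define \<sigma>2 where "\<sigma>2 = (\<Sum>k. (real k)\<^sup>2 * pmf p k) - 1"
  interpret \<mu>: prob_space \<mu> by (rule prob_space_step)
  interpret walk: critical_walk p \<sigma>2 \<mu>
    by unfold_locales (use assms sets_step in \<open>auto simp: \<sigma>2_def intro: summable_sums\<close>)
  let ?c = "6 * (\<integral>x. x\<^sup>2 \<partial>\<mu>) / \<sigma>2"
  \<comment> \<open>The mean is 0, so the variance is the second moment.\<close>
  have "0 < (\<integral>x. x\<^sup>2 \<partial>\<mu>)" using assms(4,5) by (simp add: has_bochner_integral_iff)
  then have lower: "((\<lambda>x. x\<^sup>2 * overshoot x) \<longlongrightarrow> ?c) at_top"
    by (intro walk.fixed_point_asymptotics antimono_overshoot overshoot_neg overshoot_eq)
      (auto simp: overshoot_def)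
  \<comment> \<open>The ratio of the squares tends to 1, which transfers the limit from the
    threshold \<open>x\<close> to \<open>x - 1\<close>.\<close>
  have "((\<lambda>x. x\<^sup>2 / (x - 1)\<^sup>2) \<longlongrightarrow> (1::real)) at_top" by real_asymp
  moreover have "filterlim (\<lambda>x. x - 1 :: real) at_top at_top" by real_asymp
  ultimately have "((\<lambda>x. x\<^sup>2 / (x - 1)\<^sup>2 * ((x - 1)\<^sup>2 * overshoot (x - 1))) \<longlongrightarrow> 1 * ?c) at_top"
    by (intro tendsto_mult filterlim_compose[OF lower])
  moreover have "\<forall>\<^sub>F x in at_top. x\<^sup>2 / (x - 1)\<^sup>2 * ((x - 1)\<^sup>2 * overshoot (x - 1)) = x\<^sup>2 * overshoot (x - 1)"
    using eventually_gt_at_top[of 1] by eventually_elim simp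
  ultimately have upper: "((\<lambda>x. x\<^sup>2 * overshoot (x - 1)) \<longlongrightarrow> ?c) at_top"
    using Lim_transform_eventually by force
  show ?thesis unfolding \<sigma>2_def[symmetric]
    by (rule tendsto_sandwich[OF _ _ lower upper])
      (auto intro!: always_eventually mult_left_mono prob_maximal_displacement_ge)
qed

end
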